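(* Consider the composite problem $F_*=\min_{x\in \mathrm{dom}\,\psi}\{F(x)=f(x)+\psi(x)\}$ with $f(x)=\max_{1\le i\le m} f_i(x)$, and let $x_*\in\mathrm{dom}\,\psi$ be an optimal solution. Let all functions $f_i$ have Hölder-continuous gradients in the sense that $$f_i(y)\le f_i(x)+\langle f_i'(x),y-x\rangle+\frac{L_\nu}{1+\nu}\|y-x\|^{1+\nu},\qquad x,y\in\mathrm{dom}\,\psi,\ 1\le i\le m,$$ where $\nu\in[0,1]$ and $L_\nu\ge 0$. Let $x_0\in \mathrm{dom}\,\psi$ and let the sequence $\{x_k\}_{k\ge0}$ be generated by the method $x_{k+1}=\hat T_{x_k}(\lambda_k)$, $k\ge 0$, with the step-size rule $$\lambda_k=\arg\min_{\lambda\ge0}\big\{\hat\varphi_{x_k}(\lambda)-\lambda[F(x_k)-F_*]\big\},\qquad k\ge 0.$$ Then, with $r_0=\beta_d(x_0,x_* )$, $$F_k:=\min_{0\le i\le k}F(x_i)\ \le\ F_*+\frac{L_\nu r_0^{1+\nu}}{1+\nu}\Big(\frac1k\Big)^{\frac{1+\nu}{2}},\qquad k\ge1 .$$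
   Context: $\mathbb{E}$ is a finite-dimensional real vector space with dual $\mathbb{E}^*$, $\langle s,x\rangle$ is the value of $s\in\mathbb{E}^*$ at $x\in\mathbb{E}$, and $\|\cdot\|$ is an arbitrary norm on $\mathbb{E}$. Prox-function: $d$ is continuously differentiable on a convex open domain $\mathrm{dom}\,d\subseteq\mathbb{E}$ containing the feasible set $\mathrm{dom}\,\psi$, and strongly convex there with parameter one: $d(y)\ge d(x)+\langle\nabla d(x),y-x\rangle+\frac12\|y-x\|^2$ for all $x,y\in\mathrm{dom}\,d$. Bregman distance: $\beta_d(x,y)=d(y)-d(x)-\langle\nabla d(x),y-x\rangle$. $\psi$ is a simple closed convex function; each $f_i$, $1\le i\le m$, is closed and convex on $\mathrm{dom}\,\psi$; $f_i'(x)$ denotes a subgradient of $f_i$ at $x\in\mathrm{dom}\,\psi$. The linearization of $f$ at $\bar x\in \mathrm{dom}\,\psi$ is $\ell_{\bar x}(x)=\max_{1\le i\le m}[f_i(\bar x)+\langle f_i'(\bar x),x-\bar x\rangle]$. For $\bar x\in\mathrm{dom}\,\psi$ and $\lambda\ge0$, $$\hat\varphi_{\bar x}(\lambda)=\max_{x\in\mathrm{dom}\,\psi}\big\{\lambda[F(\bar x)-\ell_{\bar x}(x)-\psi(x)]-\beta_d(\bar x,x)\big\},$$ and $\hat T_{\bar x}(\lambda)$ denotes the unique optimal solution of this maximization problem. The optimal value $F_*$ is supposed to be known (it is used in the step-size rule).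
   Formalization: The bound is proved with r_0 = sqrt(2 β_d(x_0,x_* )) instead of r_0 = β_d(x_0,x_* ); the literal bound fails, e.g. for f = d = x²/2 on R, ψ = 0, ν = L = 1, x_0 = 1/2, k = 1, where F_1 = 1/32 exceeds 1/128. *)

theory Defs
  imports "HOL-Analysis.Analysis"
begin

text \<open>
  The ambient space is a type of class \<open>real_normed_vector\<close>, whose \<open>norm\<close> is the arbitrary norm
  of the problem; finite dimension is a separate hypothesis.  Its dual is the type
  \<open>'a \<Rightarrow>\<^sub>L real\<close>, since on a finite-dimensional space every linear functional is bounded.

  An extended-valued function \<open>\<psi>\<close> is given by its effective domain \<open>Q\<close> and its (real) values on
  \<open>Q\<close>; the values of \<open>\<psi>\<close> outside \<open>Q\<close> are never used.  It is closed iff \<open>epigraph Q \<psi>\<close> is closed.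
\<close>

definition finite_dimensional_space :: "'a::real_vector itself \<Rightarrow> bool" where
  "finite_dimensional_space _ \<longleftrightarrow> (\<exists>B::'a set. finite B \<and> span B = UNIV)"

definition closed_convex_fun :: "'a::real_normed_vector set \<Rightarrow> ('a \<Rightarrow> real) \<Rightarrow> bool" where
  "closed_convex_fun Q \<psi> \<longleftrightarrow> convex_on Q \<psi> \<and> closed (epigraph Q \<psi>)"

text \<open>
  A function that is finite on \<open>Q\<close> but may have a larger domain is closed on \<open>Q\<close> if its epigraph
  over \<open>Q\<close> is closed relative to \<open>Q \<times> \<real>\<close>; \<open>Q\<close> itself need not be closed.
\<close>

definition closed_convex_fun_on :: "'a::real_normed_vector set \<Rightarrow> ('a \<Rightarrow> real) \<Rightarrow> bool" where
  "closed_convex_fun_on Q f \<longleftrightarrow>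
     convex_on Q f \<and> closedin (top_of_set (Q \<times> UNIV)) (epigraph Q f)"

definition is_subgradient ::
    "'a::real_normed_vector set \<Rightarrow> ('a \<Rightarrow> real) \<Rightarrow> 'a \<Rightarrow> ('a \<Rightarrow>\<^sub>L real) \<Rightarrow> bool" where
  "is_subgradient Q f x s \<longleftrightarrow> (\<forall>y\<in>Q. f x + blinfun_apply s (y - x) \<le> f y)"

text \<open>\<open>D\<close> is the domain of \<open>d\<close> and \<open>d'\<close> its gradient map.\<close>

definition prox_function ::
    "'a::real_normed_vector set \<Rightarrow> ('a \<Rightarrow> real) \<Rightarrow> ('a \<Rightarrow> 'a \<Rightarrow>\<^sub>L real) \<Rightarrow> bool" where
  "prox_function D d d' \<longleftrightarrow>
     open D \<and> convex D \<and>
     (\<forall>x\<in>D. (d has_derivative blinfun_apply (d' x)) (at x)) \<and>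
     continuous_on D d' \<and>
     (\<forall>x\<in>D. \<forall>y\<in>D. d y \<ge> d x + blinfun_apply (d' x) (y - x) + 1 / 2 * (norm (y - x))\<^sup>2)"

definition bregman ::
    "('a::real_normed_vector \<Rightarrow> real) \<Rightarrow> ('a \<Rightarrow> 'a \<Rightarrow>\<^sub>L real) \<Rightarrow> 'a \<Rightarrow> 'a \<Rightarrow> real" where
  "bregman d d' x y = d y - d x - blinfun_apply (d' x) (y - x)"

definition max_fun :: "nat \<Rightarrow> (nat \<Rightarrow> 'a \<Rightarrow> real) \<Rightarrow> 'a \<Rightarrow> real" where
  "max_fun m f x = (MAX i\<in>{1..m}. f i x)"

definition composite :: "nat \<Rightarrow> (nat \<Rightarrow> 'a \<Rightarrow> real) \<Rightarrow> ('a \<Rightarrow> real) \<Rightarrow> 'a \<Rightarrow> real" where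
  "composite m f \<psi> x = max_fun m f x + \<psi> x"

definition linearization ::
    "nat \<Rightarrow> (nat \<Rightarrow> 'a::real_normed_vector \<Rightarrow> real) \<Rightarrow> (nat \<Rightarrow> 'a \<Rightarrow> 'a \<Rightarrow>\<^sub>L real) \<Rightarrow> 'a \<Rightarrow> 'a \<Rightarrow> real"
  where
  "linearization m f f' xb x = (MAX i\<in>{1..m}. f i xb + blinfun_apply (f' i xb) (x - xb))"

definition step_objective ::
    "nat \<Rightarrow> (nat \<Rightarrow> 'a::real_normed_vector \<Rightarrow> real) \<Rightarrow> (nat \<Rightarrow> 'a \<Rightarrow> 'a \<Rightarrow>\<^sub>L real) \<Rightarrow> ('a \<Rightarrow> real) \<Rightarrow>
     ('a \<Rightarrow> real) \<Rightarrow> ('a \<Rightarrow> 'a \<Rightarrow>\<^sub>L real) \<Rightarrow> 'a \<Rightarrow> real \<Rightarrow> 'a \<Rightarrow> real" where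
  "step_objective m f f' \<psi> d d' xb lam x =
     lam * (composite m f \<psi> xb - linearization m f f' xb x - \<psi> x) - bregman d d' xb x"

text \<open>
  For closed convex \<open>\<psi>\<close> with effective domain \<open>Q\<close> inside the domain of the prox-function, and for
  \<open>lam \<ge> 0\<close>, the objective is bounded above on \<open>Q\<close> and attains its supremum at exactly one point
  (it is strongly concave and closed, in finite dimension), so the supremum in \<open>phi_hat\<close> is a
  genuine maximum and \<open>is_T_hat\<close> determines its last argument.
\<close>

definition phi_hat ::
    "nat \<Rightarrow> (nat \<Rightarrow> 'a::real_normed_vector \<Rightarrow> real) \<Rightarrow> (nat \<Rightarrow> 'a \<Rightarrow> 'a \<Rightarrow>\<^sub>L real) \<Rightarrow> 'a set \<Rightarrow>
     ('a \<Rightarrow> real) \<Rightarrow> ('a \<Rightarrow> real) \<Rightarrow> ('a \<Rightarrow> 'a \<Rightarrow>\<^sub>L real) \<Rightarrow> 'a \<Rightarrow> real \<Rightarrow> real" where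
  "phi_hat m f f' Q \<psi> d d' xb lam = (SUP x\<in>Q. step_objective m f f' \<psi> d d' xb lam x)"

definition is_T_hat ::
    "nat \<Rightarrow> (nat \<Rightarrow> 'a::real_normed_vector \<Rightarrow> real) \<Rightarrow> (nat \<Rightarrow> 'a \<Rightarrow> 'a \<Rightarrow>\<^sub>L real) \<Rightarrow> 'a set \<Rightarrow>
     ('a \<Rightarrow> real) \<Rightarrow> ('a \<Rightarrow> real) \<Rightarrow> ('a \<Rightarrow> 'a \<Rightarrow>\<^sub>L real) \<Rightarrow> 'a \<Rightarrow> real \<Rightarrow> 'a \<Rightarrow> bool" where
  "is_T_hat m f f' Q \<psi> d d' xb lam x \<longleftrightarrow>
     is_arg_max (step_objective m f f' \<psi> d d' xb lam) (\<lambda>y. y \<in> Q) x"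

end

theory Submission
  imports Defs
begin

text \<open>
  Write \<open>h\<close> for the model \<open>\<ell> + \<psi>\<close> at \<open>x\<^sub>k\<close> and \<open>T = x\<^sub>k\<^sub>+\<^sub>1\<close>.  The envelope \<open>\<phi>\<close> has derivative
  \<open>F(x\<^sub>k) - h(T)\<close> at \<open>\<lambda>\<^sub>k\<close>, so the step-size rule says \<open>h(T) \<le> F\<^sub>*\<close>, with equality when
  \<open>\<lambda>\<^sub>k > 0\<close>.  By the smoothness condition, \<open>F(T) - F\<^sub>*\<close> is then bounded by
  \<open>L / (1 + \<nu>) \<parallel>T - x\<^sub>k\<parallel>\<^bsup>1 + \<nu>\<^esup>\<close>, while the optimality condition for \<open>T\<close> gives
  \<open>\<beta>(T, x\<^sub>*) + \<beta>(x\<^sub>k, T) \<le> \<beta>(x\<^sub>k, x\<^sub>*)\<close>.  Summing the latter, some step among the first \<open>k\<close>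
  has squared length at most \<open>r\<^sub>0\<^sup>2 / k\<close>.
\<close>

section \<open>Bregman distances and optimality at a maximiser\<close>

lemma bregman_ge:
  assumes "prox_function D d d'" "x \<in> D" "y \<in> D"
  shows "1 / 2 * (norm (y - x))\<^sup>2 \<le> bregman d d' x y"
  using assms unfolding prox_function_def bregman_def by force

lemma bregman_three_point:
  "bregman d d' x z = bregman d d' x y + bregman d d' y z + blinfun_apply (d' y - d' x) (z - y)"
  unfolding bregman_def by (simp add: blinfun.diff_left blinfun.diff_right)

text \<open>Moving from \<open>T\<close> towards \<open>y\<close>, maximality bounds the right
  derivative of the Bregman term from below; \<open>h\<close> enters only through convexity along
  the segment. The identity \<open>bregman_three_point\<close> turns that derivative into Bregman
  distances.\<close>

lemma argmax_bregman_three_point: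
  fixes h :: "'a::real_normed_vector \<Rightarrow> real"
  assumes prox: "prox_function D d d'" and "Q \<subseteq> D" and h: "convex_on Q h" and "t \<ge> 0"
    and max: "is_arg_max (\<lambda>y. t * (c - h y) - bregman d d' x y) (\<lambda>y. y \<in> Q) T"
    and "y \<in> Q"
  shows "t * (c - h y) - bregman d d' x y + bregman d d' T y \<le> t * (c - h T) - bregman d d' x T"
proof -
  have T: "T \<in> Q" and le: "\<And>z. z \<in> Q \<Longrightarrow> t * (c - h z) - bregman d d' x z \<le> t * (c - h T) - bregman d d' x T"
    using max unfolding is_arg_max_linorder by auto
  define p where "p s = T + s *\<^sub>R (y - T)" for s :: real
  define q where "q s = bregman d d' x (p s)" for s :: real
  have "(d has_derivative blinfun_apply (d' T)) (at T)"
    using prox T \<open>Q \<subseteq> D\<close> unfolding prox_function_def by auto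
  then have dd: "(d has_derivative blinfun_apply (d' T)) (at (p 0))"
    by (simp add: p_def)
  have dp: "(p has_derivative (\<lambda>s. s *\<^sub>R (y - T))) (at 0)"
    unfolding p_def by (auto intro!: derivative_eq_intros)
  have "((\<lambda>s. d (p s)) has_derivative (\<lambda>s. d' T (s *\<^sub>R (y - T)))) (at 0)"
    using has_derivative_compose[OF dp dd] .
  then have "(q has_derivative (\<lambda>s. d' T (s *\<^sub>R (y - T)) - d' x (s *\<^sub>R (y - T)))) (at 0)"
    unfolding q_def bregman_def p_def by (auto intro!: derivative_eq_intros)
  then have "(q has_real_derivative blinfun_apply (d' T - d' x) (y - T)) (at 0)"
    unfolding has_field_derivative_def
    by (rule has_derivative_eq_rhs)
      (auto simp: fun_eq_iff blinfun.scaleR_right blinfun.diff_left algebra_simps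
        simp del: scaleR_right_diff_distrib)
  then have lim: "((\<lambda>s. (q s - q 0) / s) \<longlongrightarrow> blinfun_apply (d' T - d' x) (y - T)) (at_right 0)"
    unfolding has_field_derivative_iff by (auto intro: tendsto_mono[OF at_le])
  \<comment> \<open>Maximality against \<open>p s\<close>, with convexity of \<open>h\<close>,
    divided by \<open>s\<close>. The left side is free of \<open>s\<close>, so the bound survives
    the limit.\<close>
  have "t * (h T - h y) \<le> (q s - q 0) / s" if "0 < s" "s < 1" for s
  proof -
    have ps: "p s = (1 - s) *\<^sub>R T + s *\<^sub>R y"
      by (simp add: p_def algebra_simps)
    have "p s \<in> Q"
      unfolding ps using that T \<open>y \<in> Q\<close> convex_on_imp_convex[OF h] by (auto simp: convex_alt)
    have "h (p s) \<le> (1 - s) * h T + s * h y"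
      unfolding ps using convex_onD[OF h] that T \<open>y \<in> Q\<close> by auto
    then have "t * h (p s) \<le> t * ((1 - s) * h T + s * h y)"
      using \<open>t \<ge> 0\<close> by (rule mult_left_mono)
    then have "s * (t * (h T - h y)) \<le> q s - q 0"
      using le[OF \<open>p s \<in> Q\<close>] by (simp add: q_def p_def algebra_simps)
    then show ?thesis
      using that by (simp add: field_simps)
  qed
  then have "\<forall>\<^sub>F s in at_right 0. t * (h T - h y) \<le> (q s - q 0) / s"
    unfolding eventually_at_right_field by (intro exI[of _ 1]) auto
  then have "t * (h T - h y) \<le> blinfun_apply (d' T - d' x) (y - T)"
    using tendsto_lowerbound[OF lim] by simp
  then show ?thesis
    using bregman_three_point[of d d' x y T] by (simp add: algebra_simps)
qed

section \<open>Lower semicontinuity and linear minorants\<close>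

lemma closed_epigraph_lsc:
  fixes \<psi> :: "'a::real_normed_vector \<Rightarrow> real"
  assumes "closed (epigraph Q \<psi>)" and "e > 0"
  obtains r where "r > 0" "\<And>y. y \<in> Q \<Longrightarrow> norm (y - T) < r \<Longrightarrow> \<psi> T - e < \<psi> y"
proof -
  have "(T, \<psi> T - e) \<in> - epigraph Q \<psi>"
    using \<open>e > 0\<close> by (simp add: mem_epigraph)
  moreover have "open (- epigraph Q \<psi>)"
    using assms by (simp add: open_Compl)
  ultimately obtain r where r: "r > 0" "\<And>z. dist z (T, \<psi> T - e) < r \<Longrightarrow> z \<in> - epigraph Q \<psi>"
    by (metis open_dist)
  \<comment> \<open>The slice of the ball at height \<open>\<psi> T - e\<close> misses the
    epigraph.\<close>
  have "\<psi> T - e < \<psi> y" if "y \<in> Q" "norm (y - T) < r" for y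
    using r(2)[of "(y, \<psi> T - e)"] that by (auto simp: dist_Pair_Pair dist_norm mem_epigraph)
  with r(1) show ?thesis
    using that by blast
qed

text \<open>A far point is pulled back along the segment into the ball, and convexity makes the loss
  of at most \<open>e\<close> there scale with the distance. The minorant replaces a subgradient at
  \<open>T\<close>, which may fail to exist.\<close>

lemma convex_lsc_imp_linear_lower_bound:
  fixes h :: "'a::real_normed_vector \<Rightarrow> real"
  assumes h: "convex_on Q h" and "T \<in> Q" and "r > 0" and "e > 0"
    and lsc: "\<And>y. y \<in> Q \<Longrightarrow> norm (y - T) < r \<Longrightarrow> h T - e < h y"
    and "y \<in> Q"
  shows "h T - e - (2 * e / r) * norm (y - T) \<le> h y"
proof (cases "norm (y - T) < r")
  case True
  then show ?thesis
    using lsc[OF \<open>y \<in> Q\<close>] \<open>e > 0\<close> \<open>r > 0\<close>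
    by (smt (verit) divide_nonneg_pos mult_nonneg_nonneg norm_ge_zero)
next
  case False
  define n where "n = norm (y - T)"
  have "n \<ge> r" using False by (simp add: n_def)
  \<comment> \<open>Puts \<open>z\<close> at distance \<open>r / 2\<close> from \<open>T\<close>,
    strictly inside the ball; hence the factor 2 in the slope.\<close>
  define s where "s = r / (2 * n)"
  have s: "0 < s" "s < 1" using \<open>n \<ge> r\<close> \<open>r > 0\<close> by (auto simp: s_def field_simps)
  define z where "z = (1 - s) *\<^sub>R T + s *\<^sub>R y"
  have "z \<in> Q"
    using s \<open>T \<in> Q\<close> \<open>y \<in> Q\<close> convex_on_imp_convex[OF h] by (auto simp: z_def convex_alt)
  have "z - T = s *\<^sub>R (y - T)"
    by (simp add: z_def algebra_simps)
  then have "norm (z - T) = s * n"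
    using s by (simp add: n_def)
  then have "norm (z - T) < r"
    using \<open>n \<ge> r\<close> \<open>r > 0\<close> by (simp add: s_def)
  then have "h T - e < h z"
    using lsc \<open>z \<in> Q\<close> by blast
  also have "h z \<le> (1 - s) * h T + s * h y"
    unfolding z_def using convex_onD[OF h] s \<open>T \<in> Q\<close> \<open>y \<in> Q\<close> by auto
  finally have "s * (h T - h y) < e"
    by (simp add: algebra_simps)
  then have "h T - h y < e / s"
    using s by (simp add: field_simps)
  also have "e / s = (2 * e / r) * n"
    using \<open>n \<ge> r\<close> \<open>r > 0\<close> by (simp add: s_def)
  finally show ?thesis
    using \<open>e > 0\<close> by (simp add: n_def)
qed

section \<open>Elementary estimates with quadratic terms\<close>

lemma linear_minus_quadratic_le:
  fixes a b r :: real
  assumes "b > 0"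
  shows "a * r - b * r\<^sup>2 \<le> a\<^sup>2 / (4 * b)"
proof -
  have "0 \<le> (a - 2 * b * r)\<^sup>2" by simp
  then have "(a * r - b * r\<^sup>2) * (4 * b) \<le> a\<^sup>2"
    by (simp add: power2_eq_square algebra_simps)
  then show ?thesis
    using assms by (simp add: field_simps)
qed

text \<open>Divide by \<open>h\<close> and let \<open>h\<close> tend to 0 from the right. This
  stands in for differentiating the envelope: a perturbed step gives a first-order term and a
  quadratic error.\<close>

lemma slope_nonneg_if_quadratic_upper_bound:
  fixes a C b :: real
  assumes "b > 0" and "\<And>h. 0 < h \<Longrightarrow> h \<le> b \<Longrightarrow> 0 \<le> h * a + C * h\<^sup>2"
  shows "0 \<le> a"
proof -
  have "0 \<le> a + C * h" if "0 < h" "h < b" for h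
  proof -
    have "0 \<le> h * (a + C * h)"
      using assms(2)[of h] that by (simp add: power2_eq_square algebra_simps)
    then show ?thesis
      using that by (simp add: zero_le_mult_iff)
  qed
  then have "\<forall>\<^sub>F h in at_right 0. 0 \<le> a + C * h"
    unfolding eventually_at_right_field using \<open>b > 0\<close> by blast
  moreover have "((\<lambda>h. a + C * h) \<longlongrightarrow> a + C * 0) (at_right 0)"
    by (intro tendsto_intros)
  ultimately show ?thesis
    using tendsto_lowerbound by force
qed

section \<open>Optimality of the step size\<close>

context
  fixes Q D :: "'a::real_normed_vector set" and h d :: "'a \<Rightarrow> real" and d' :: "'a \<Rightarrow> 'a \<Rightarrow>\<^sub>L real"
    and c u t :: real and x T :: 'a and \<phi> :: "real \<Rightarrow> real"
  assumes prox: "prox_function D d d'" and QD: "Q \<subseteq> D" and h: "convex_on Q h" and xQ: "x \<in> Q"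
    and max: "is_arg_max (\<lambda>y. t * (c - h y) - bregman d d' x y) (\<lambda>y. y \<in> Q) T"
    and \<phi>: "\<phi> = (\<lambda>s. SUP y\<in>Q. s * (c - h y) - bregman d d' x y)"
    and min: "is_arg_min (\<lambda>s. \<phi> s - s * (c - u)) (\<lambda>s. s \<ge> 0) t"
begin

lemma envelope_at_argmax: "\<phi> t = t * (c - h T) - bregman d d' x T"
  using max unfolding \<phi> is_arg_max_linorder by (auto intro!: cSup_eq_maximum)

text \<open>Tests the step-size rule against a rival step \<open>s\<close>. Any upper bound
  \<open>B\<close> on the objective at \<open>s\<close> suffices, so no maximiser for
  \<open>s\<close> has to be found. Later \<open>c\<close> is the current value of the composite
  function and \<open>u\<close> the optimal one.\<close>

lemma minimal_step_le:
  assumes "s \<ge> 0" and "\<And>y. y \<in> Q \<Longrightarrow> s * (c - h y) - bregman d d' x y \<le> B"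
  shows "t * (u - h T) - bregman d d' x T \<le> B - s * (c - u)"
proof -
  have "\<phi> s \<le> B"
    unfolding \<phi> using xQ assms by (intro cSUP_least) auto
  moreover have "\<phi> t - t * (c - u) \<le> \<phi> s - s * (c - u)"
    using min \<open>s \<ge> 0\<close> unfolding is_arg_min_linorder by auto
  ultimately show ?thesis
    using envelope_at_argmax by (simp add: algebra_simps)
qed

text \<open>Strong convexity of the prox-function supplies a quadratic margin, the slack that
  absorbs linear errors when the step is perturbed.\<close>

lemma three_point:
  assumes "y \<in> Q"
  shows "t * (c - h y) - bregman d d' x y + 1 / 2 * (norm (y - T))\<^sup>2
           \<le> t * (c - h T) - bregman d d' x T"
proof -
  have "t \<ge> 0" using min unfolding is_arg_min_linorder by auto
  have "T \<in> Q" using max unfolding is_arg_max_linorder by auto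
  have "1 / 2 * (norm (y - T))\<^sup>2 \<le> bregman d d' T y"
    using bregman_ge[OF prox] QD \<open>T \<in> Q\<close> assms by blast
  then show ?thesis
    using argmax_bregman_three_point[OF prox QD h \<open>t \<ge> 0\<close> max assms] by linarith
qed

text \<open>Lengthening the step to \<open>t + s\<close> must not lower the minimised function, yet
  semicontinuity at \<open>T\<close> limits its first-order growth to \<open>u - h T\<close>, up to
  \<open>e\<close>.\<close>

lemma minimal_step_model_le:
  assumes lsc: "\<And>e. e > 0 \<Longrightarrow> \<exists>r>0. \<forall>y\<in>Q. norm (y - T) < r \<longrightarrow> h T - e < h y"
  shows "h T \<le> u"
proof (rule field_le_epsilon)
  fix e :: real
  assume "e > 0"
  have T: "T \<in> Q" using max unfolding is_arg_max_linorder by auto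
  have "t \<ge> 0" using min unfolding is_arg_min_linorder by auto
  obtain r where r: "r > 0" "\<And>y. y \<in> Q \<Longrightarrow> norm (y - T) < r \<Longrightarrow> h T - e < h y"
    using lsc[OF \<open>e > 0\<close>] by blast
  \<comment> \<open>\<open>A\<close> may grow as \<open>e\<close> shrinks, so \<open>e\<close> stays
    fixed while \<open>s\<close> tends to 0.\<close>
  define A where "A = 2 * e / r"
  have lower: "h T - e - A * norm (y - T) \<le> h y" if "y \<in> Q" for y
    unfolding A_def using convex_lsc_imp_linear_lower_bound[OF h T r(1) \<open>e > 0\<close> r(2) that] .
  have "0 \<le> u + e - h T"
  proof (rule slope_nonneg_if_quadratic_upper_bound[where b = 1 and C = "A\<^sup>2 / 2"])
    fix s :: real
    assume s: "0 < s" "s \<le> 1"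
    have "(t + s) * (c - h y) - bregman d d' x y
            \<le> t * (c - h T) - bregman d d' x T + s * (c - h T + e) + A\<^sup>2 / 2 * s\<^sup>2"
      if "y \<in> Q" for y
    proof -
      have "s * (c - h y) \<le> s * (c - h T + e + A * norm (y - T))"
        using lower[OF that] s by (intro mult_left_mono) auto
      moreover have "s * A * norm (y - T) - 1 / 2 * (norm (y - T))\<^sup>2 \<le> A\<^sup>2 / 2 * s\<^sup>2"
        using linear_minus_quadratic_le[of "1 / 2" "s * A" "norm (y - T)"]
        by (simp add: power_mult_distrib mult.commute)
      ultimately show ?thesis
        using three_point[OF that] by (simp add: algebra_simps)
    qed
    from minimal_step_le[OF _ this]
    show "0 \<le> s * (u + e - h T) + A\<^sup>2 / 2 * s\<^sup>2"
      using s \<open>t \<ge> 0\<close> by (simp add: algebra_simps)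
  qed simp
  then show "h T \<le> u + e" by simp
qed

text \<open>
  For steps \<open>s < t\<close> the semicontinuity of \<open>h\<close> is on the wrong side.  Instead the objective at
  \<open>s\<close> is written as \<open>s / t\<close> times the objective at \<open>t\<close> minus \<open>1 - s / t\<close> times the Bregman
  distance, which is differentiable at \<open>T\<close>.
\<close>

lemma minimal_step_model_ge:
  assumes "t > 0"
  shows "u \<le> h T"
proof -
  have T: "T \<in> Q" using max unfolding is_arg_max_linorder by auto
  define M where "M = norm (d' T - d' x)"
  \<comment> \<open>In the three-point identity, drop the nonnegative
    \<open>bregman d d' T y\<close> and bound the linear term by the operator norm.\<close>
  have lower: "bregman d d' x T - M * norm (y - T) \<le> bregman d d' x y" if "y \<in> Q" for y
  proof -
    have "0 \<le> 1 / 2 * (norm (y - T))\<^sup>2" by simp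
    also have "\<dots> \<le> bregman d d' T y"
      using bregman_ge[OF prox] QD T that by blast
    finally have "0 \<le> bregman d d' T y" .
    moreover have "\<bar>blinfun_apply (d' T - d' x) (y - T)\<bar> \<le> M * norm (y - T)"
      using norm_blinfun[of "d' T - d' x" "y - T"] by (simp add: M_def)
    ultimately show ?thesis
      using bregman_three_point[of d d' x y T] by linarith
  qed
  have "0 \<le> h T - u"
  \<comment> \<open>The cap \<open>t / 2\<close> keeps \<open>1 - p\<close> at least 1/2, leaving a
    quarter of the squared distance to absorb the linear term. \<open>C\<close> comes from the error
    \<open>M\<^sup>2 * p\<^sup>2\<close> with \<open>p = s / t\<close>.\<close>
  proof (rule slope_nonneg_if_quadratic_upper_bound[where b = "t / 2" and C = "M\<^sup>2 / t\<^sup>2"])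
    fix s :: real
    assume s: "0 < s" "s \<le> t / 2"
    define p where "p = s / t"
    have p: "0 < p" "p \<le> 1 / 2" "s = p * t"
      using s assms by (auto simp: p_def field_simps)
    have "(t - s) * (c - h y) - bregman d d' x y
            \<le> (t - s) * (c - h T) - bregman d d' x T + M\<^sup>2 * p\<^sup>2"
      if "y \<in> Q" for y
    proof -
      have "(1 - p) * (t * (c - h y) - bregman d d' x y + 1 / 2 * (norm (y - T))\<^sup>2)
              \<le> (1 - p) * (t * (c - h T) - bregman d d' x T)"
        using three_point[OF that] p by (intro mult_left_mono) auto
      moreover have "p * (bregman d d' x T - M * norm (y - T)) \<le> p * bregman d d' x y"
        using lower[OF that] p by (intro mult_left_mono) auto
      moreover have "1 / 4 * (norm (y - T))\<^sup>2 \<le> (1 - p) * (1 / 2 * (norm (y - T))\<^sup>2)"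
        using mult_right_mono[of "1 / 2" "1 - p" "1 / 2 * (norm (y - T))\<^sup>2"] p by simp
      moreover have "p * M * norm (y - T) - 1 / 4 * (norm (y - T))\<^sup>2 \<le> M\<^sup>2 * p\<^sup>2"
        using linear_minus_quadratic_le[of "1 / 4" "p * M" "norm (y - T)"]
        by (simp add: power_mult_distrib mult.commute)
      ultimately show ?thesis
        unfolding p(3) by (simp add: algebra_simps diff_divide_distrib)
    qed
    from minimal_step_le[OF _ this]
    have "0 \<le> s * (h T - u) + M\<^sup>2 * p\<^sup>2"
      using s assms by (simp add: algebra_simps)
    then show "0 \<le> s * (h T - u) + M\<^sup>2 / t\<^sup>2 * s\<^sup>2"
      by (simp add: p_def power_divide)
  qed (use assms in simp)
  then show ?thesis by simp
qed

end

section \<open>Linearization of a finite maximum\<close>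

lemma linearization_ge:
  "i \<in> {1..m} \<Longrightarrow> f i xb + blinfun_apply (f' i xb) (y - xb) \<le> linearization m f f' xb y"
  unfolding linearization_def by (rule Max_ge) auto

lemma linearization_attained:
  assumes "m \<ge> 1"
  obtains i where "i \<in> {1..m}"
    "linearization m f f' xb y = f i xb + blinfun_apply (f' i xb) (y - xb)"
proof -
  have "linearization m f f' xb y \<in> (\<lambda>i. f i xb + blinfun_apply (f' i xb) (y - xb)) ` {1..m}"
    unfolding linearization_def using assms by (intro Max_in) auto
  then show ?thesis using that by blast
qed

lemma linearization_convex:
  assumes "m \<ge> 1" and "convex Q"
  shows "convex_on Q (linearization m f f' xb)"
proof (rule convex_onI)
  fix s :: real and y z
  assume s: "0 < s" "s < 1"
  obtain i where i: "i \<in> {1..m}" and eq: "linearization m f f' xb ((1 - s) *\<^sub>R y + s *\<^sub>R z)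
      = f i xb + blinfun_apply (f' i xb) ((1 - s) *\<^sub>R y + s *\<^sub>R z - xb)"
    using linearization_attained[OF \<open>m \<ge> 1\<close>] .
  have "\<dots> = (1 - s) * (f i xb + blinfun_apply (f' i xb) (y - xb))
              + s * (f i xb + blinfun_apply (f' i xb) (z - xb))"
    by (simp add: blinfun.diff_right blinfun.add_right blinfun.scaleR_right algebra_simps)
  also have "\<dots> \<le> (1 - s) * linearization m f f' xb y + s * linearization m f f' xb z"
    using s i by (intro add_mono mult_left_mono linearization_ge) auto
  finally show "linearization m f f' xb ((1 - s) *\<^sub>R y + s *\<^sub>R z)
      \<le> (1 - s) * linearization m f f' xb y + s * linearization m f f' xb z"
    using eq by simp
qed (rule \<open>convex Q\<close>)

text \<open>The affine piece active at \<open>T\<close> minorises the maximum and is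
  Lipschitz.\<close>

lemma linearization_lsc:
  assumes "m \<ge> 1" and "e > 0"
  obtains r where "r > 0"
    "\<And>y. norm (y - T) < r \<Longrightarrow> linearization m f f' xb T - e < linearization m f f' xb y"
proof -
  obtain i where i: "i \<in> {1..m}"
    and eq: "linearization m f f' xb T = f i xb + blinfun_apply (f' i xb) (T - xb)"
    using linearization_attained[OF \<open>m \<ge> 1\<close>] .
  \<comment> \<open>The extra 1 keeps \<open>e / M\<close> a valid radius when the active gradient
    vanishes.\<close>
  define M where "M = norm (f' i xb) + 1"
  have "M > 0" by (simp add: M_def add_nonneg_pos)
  have "linearization m f f' xb T - e < linearization m f f' xb y" if "norm (y - T) < e / M" for y
  proof -
    have "\<bar>blinfun_apply (f' i xb) (y - T)\<bar> \<le> norm (f' i xb) * norm (y - T)"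
      using norm_blinfun[of "f' i xb" "y - T"] by simp
    also have "\<dots> \<le> M * norm (y - T)"
      by (intro mult_right_mono) (auto simp: M_def)
    also have "\<dots> < e"
      using that \<open>M > 0\<close> by (simp add: field_simps)
    finally have "- e < blinfun_apply (f' i xb) (y - xb) - blinfun_apply (f' i xb) (T - xb)"
      by (simp add: blinfun.diff_right)
    then show ?thesis
      using linearization_ge[OF i, of f xb f' y] eq by linarith
  qed
  then show ?thesis
    using that[of "e / M"] \<open>M > 0\<close> \<open>e > 0\<close> by simp
qed

text \<open>The subgradient inequality for the active piece; at the minimiser it puts the model at
  or below the optimal value.\<close>

lemma linearization_le_max_fun:
  assumes "m \<ge> 1" and "\<And>i. i \<in> {1..m} \<Longrightarrow> is_subgradient Q (f i) xb (f' i xb)" and "y \<in> Q"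
  shows "linearization m f f' xb y \<le> max_fun m f y"
proof -
  obtain i where i: "i \<in> {1..m}"
    and eq: "linearization m f f' xb y = f i xb + blinfun_apply (f' i xb) (y - xb)"
    using linearization_attained[OF \<open>m \<ge> 1\<close>] .
  have "\<dots> \<le> f i y"
    using assms(2)[OF i] \<open>y \<in> Q\<close> unfolding is_subgradient_def by blast
  also have "\<dots> \<le> max_fun m f y"
    unfolding max_fun_def using i by (intro Max_ge) auto
  finally show ?thesis using eq by simp
qed

text \<open>An error common to all pieces passes to the maximum; \<open>E\<close> will be the
  Hoelder term.\<close>

lemma max_fun_le_linearization:
  assumes "m \<ge> 1"
    and "\<And>i. i \<in> {1..m} \<Longrightarrow> f i y \<le> f i xb + blinfun_apply (f' i xb) (y - xb) + E"
  shows "max_fun m f y \<le> linearization m f f' xb y + E"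
  unfolding max_fun_def
proof (rule Max.boundedI)
  fix v
  assume "v \<in> (\<lambda>i. f i y) ` {1..m}"
  then obtain i where "i \<in> {1..m}" "v = f i y" by blast
  then show "v \<le> linearization m f f' xb y + E"
    using assms(2)[of i] linearization_ge[of i m f xb f' y] by linarith
qed (use assms in auto)

section \<open>Averaging and the rate of convergence\<close>

lemma exists_small_term:
  fixes a V :: "nat \<Rightarrow> real"
  assumes "\<And>i. V (Suc i) + a i \<le> V i" and "\<And>i. 0 \<le> V i" and "k \<ge> 1"
  obtains i where "i < k" "a i \<le> V 0 / real k"
proof -
  have sum: "V k + (\<Sum>i<k. a i) \<le> V 0" for k
  proof (induction k)
    case (Suc k)
    then show ?case using assms(1)[of k] by simp
  qed simp
  have "\<exists>i<k. a i \<le> V 0 / real k"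
  proof (rule ccontr)
    assume "\<not> ?thesis"
    then have "(\<Sum>i<k. V 0 / real k) < (\<Sum>i<k. a i)"
      using \<open>k \<ge> 1\<close> by (intro sum_strict_mono) (auto simp: not_le lessThan_empty_iff)
    then show False
      using sum[of k] assms(2)[of k] \<open>k \<ge> 1\<close> by simp
  qed
  then show ?thesis using that by blast
qed

theorem theorem1:
  fixes Q D :: "'a::real_normed_vector set"
    and m :: nat
    and f :: "nat \<Rightarrow> 'a \<Rightarrow> real" and f' :: "nat \<Rightarrow> 'a \<Rightarrow> 'a \<Rightarrow>\<^sub>L real"
    and \<psi> :: "'a \<Rightarrow> real"
    and d :: "'a \<Rightarrow> real" and d' :: "'a \<Rightarrow> 'a \<Rightarrow>\<^sub>L real"
    and \<nu> L Fstar r0 :: real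
    and xstar :: 'a and x :: "nat \<Rightarrow> 'a" and lam :: "nat \<Rightarrow> real"
  assumes "finite_dimensional_space TYPE('a)"
    and "prox_function D d d'" and "Q \<subseteq> D"
    and "closed_convex_fun Q \<psi>"
    and "m \<ge> 1"
    and "\<And>i. i \<in> {1..m} \<Longrightarrow> closed_convex_fun_on Q (f i)"
    and "\<And>i y. i \<in> {1..m} \<Longrightarrow> y \<in> Q \<Longrightarrow> is_subgradient Q (f i) y (f' i y)"
    and "0 \<le> \<nu>" and "\<nu> \<le> 1" and "L \<ge> 0"
    and "\<And>i y z. i \<in> {1..m} \<Longrightarrow> y \<in> Q \<Longrightarrow> z \<in> Q \<Longrightarrow>
           f i z \<le> f i y + blinfun_apply (f' i y) (z - y)
                    + L / (1 + \<nu>) * norm (z - y) powr (1 + \<nu>)"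
    and "is_arg_min (composite m f \<psi>) (\<lambda>y. y \<in> Q) xstar"
    and "Fstar = composite m f \<psi> xstar"
    and "x 0 \<in> Q"
    and "\<And>k. is_arg_min
           (\<lambda>t. phi_hat m f f' Q \<psi> d d' (x k) t - t * (composite m f \<psi> (x k) - Fstar))
           (\<lambda>t. t \<ge> 0) (lam k)"
    and "\<And>k. is_T_hat m f f' Q \<psi> d d' (x k) (lam k) (x (Suc k))"
    and "r0 = sqrt (2 * bregman d d' (x 0) xstar)"
  shows "\<forall>k\<ge>1. (MIN i\<in>{0..k}. composite m f \<psi> (x i))
           \<le> Fstar + L * r0 powr (1 + \<nu>) / (1 + \<nu>) * (1 / real k) powr ((1 + \<nu>) / 2)"
proof (intro allI impI)
  fix k :: nat
  assume k: "k \<ge> 1"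
  note prox = assms(2) and QD = assms(3)
  have \<psi>: "convex_on Q \<psi>" and epi: "closed (epigraph Q \<psi>)"
    using assms(4) by (auto simp: closed_convex_fun_def)
  have xstar: "xstar \<in> Q"
    using assms(12) by (simp add: is_arg_min_def)
  have T: "x (Suc j) \<in> Q" for j
    using assms(16)[of j] by (simp add: is_T_hat_def is_arg_max_def)
  have xQ: "x j \<in> Q" for j
    using T assms(14) by (cases j) auto
  define h where "h j y = linearization m f f' (x j) y + \<psi> y" for j y
  have h: "convex_on Q (h j)" for j
    unfolding h_def
    using linearization_convex[OF assms(5) convex_on_imp_convex[OF \<psi>]] \<psi> by (rule convex_on_add)
  have obj: "step_objective m f f' \<psi> d d' (x j) t
      = (\<lambda>y. t * (composite m f \<psi> (x j) - h j y) - bregman d d' (x j) y)" for j t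
    by (simp add: fun_eq_iff step_objective_def h_def diff_diff_eq)
  have max: "is_arg_max (\<lambda>y. lam j * (composite m f \<psi> (x j) - h j y) - bregman d d' (x j) y)
      (\<lambda>y. y \<in> Q) (x (Suc j))" for j
    using assms(16)[of j] by (simp add: is_T_hat_def obj)
  have \<phi>: "phi_hat m f f' Q \<psi> d d' (x j)
      = (\<lambda>t. SUP y\<in>Q. t * (composite m f \<psi> (x j) - h j y) - bregman d d' (x j) y)" for j
    by (simp add: fun_eq_iff phi_hat_def obj)
  have lsc: "\<exists>r>0. \<forall>y\<in>Q. norm (y - T) < r \<longrightarrow> h j T - e < h j y" if e: "e > 0" for e j T
  proof -
    obtain r1 where r1: "r1 > 0" "\<And>y. y \<in> Q \<Longrightarrow> norm (y - T) < r1 \<Longrightarrow> \<psi> T - e / 2 < \<psi> y"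
      using closed_epigraph_lsc[OF epi half_gt_zero[OF e]] by blast
    obtain r2 where r2: "r2 > 0" "\<And>y. norm (y - T) < r2 \<Longrightarrow>
        linearization m f f' (x j) T - e / 2 < linearization m f f' (x j) y"
      using linearization_lsc[OF assms(5) half_gt_zero[OF e]] by blast
    have "h j T - e < h j y" if "y \<in> Q" "norm (y - T) < min r1 r2" for y
      using r1(2)[of y] r2(2)[of y] that by (simp add: h_def)
    with r1(1) r2(1) show ?thesis
      by (intro exI[of _ "min r1 r2"]) auto
  qed
  have model_le: "h j (x (Suc j)) \<le> Fstar" for j
    using minimal_step_model_le[OF prox QD h xQ max \<phi> assms(15) lsc] .
  have lam: "lam j \<ge> 0" for j
    using assms(15)[of j] by (simp add: is_arg_min_def)
  \<comment> \<open>Complementary slackness in the one direction needed: a zero step makes the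
    product vanish, and a positive one gives \<open>Fstar \<le> h j (x (Suc j))\<close>.\<close>
  have compl: "lam j * (Fstar - h j (x (Suc j))) \<le> 0" for j
  proof (cases "lam j > 0")
    case True
    then show ?thesis
      using minimal_step_model_ge[OF prox QD h xQ max \<phi> assms(15)] by (simp add: mult_le_0_iff)
  next
    case False
    then show ?thesis using lam[of j] by simp
  qed
  \<comment> \<open>The three-point inequality at \<open>xstar\<close>: the model term is at most
    \<open>lam j * (Fstar - h j (x (Suc j)))\<close>, hence nonpositive by
    \<open>compl\<close>.\<close>
  have descent: "bregman d d' (x (Suc j)) xstar + 1 / 2 * (norm (x (Suc j) - x j))\<^sup>2
      \<le> bregman d d' (x j) xstar" for j
  proof -
    have "linearization m f f' (x j) xstar \<le> max_fun m f xstar"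
      using linearization_le_max_fun[OF assms(5) _ xstar] assms(7) xQ by blast
    then have "h j xstar \<le> Fstar"
      by (simp add: h_def assms(13) composite_def)
    then have "lam j * h j xstar \<le> lam j * Fstar"
      using lam by (rule mult_left_mono)
    moreover have "1 / 2 * (norm (x (Suc j) - x j))\<^sup>2 \<le> bregman d d' (x j) (x (Suc j))"
      using bregman_ge[OF prox] QD xQ by blast
    ultimately show ?thesis
      using argmax_bregman_three_point[OF prox QD h lam max xstar, of j] compl[of j]
      by (simp add: algebra_simps)
  qed
  have breg_nonneg: "0 \<le> bregman d d' (x j) xstar" for j
  proof -
    have "0 \<le> 1 / 2 * (norm (xstar - x j))\<^sup>2" by simp
    also have "\<dots> \<le> bregman d d' (x j) xstar"
      using bregman_ge[OF prox] QD xQ xstar by blast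
    finally show ?thesis .
  qed
  obtain i where i: "i < k"
    and small: "1 / 2 * (norm (x (Suc i) - x i))\<^sup>2 \<le> bregman d d' (x 0) xstar / real k"
    using exists_small_term[where V = "\<lambda>j. bregman d d' (x j) xstar", OF descent breg_nonneg k] .
  define n where "n = norm (x (Suc i) - x i)"
  \<comment> \<open>\<open>r0\<close> is a length: half its square is the initial Bregman distance,
    which cancels the 1/2 in \<open>small\<close> and bounds the short step by
    \<open>r0 / sqrt k\<close>.\<close>
  have r0: "r0 \<ge> 0" "r0\<^sup>2 = 2 * bregman d d' (x 0) xstar"
    using breg_nonneg[of 0] by (auto simp: assms(17))
  have "n\<^sup>2 \<le> r0\<^sup>2 * (1 / real k)"
    using small by (simp add: r0(2) n_def field_simps)
  then have "n \<le> sqrt (r0\<^sup>2 * (1 / real k))"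
    by (rule real_le_rsqrt)
  also have "\<dots> = r0 * (1 / real k) powr (1 / 2)"
    using r0(1) by (simp add: real_sqrt_mult real_sqrt_divide powr_half_sqrt)
  finally have "n powr (1 + \<nu>) \<le> (r0 * (1 / real k) powr (1 / 2)) powr (1 + \<nu>)"
    using assms(8) by (intro powr_mono2) (auto simp: n_def)
  also have "\<dots> = r0 powr (1 + \<nu>) * (1 / real k) powr ((1 + \<nu>) / 2)"
    using r0(1) by (simp add: powr_mult powr_powr)
  finally have n: "n powr (1 + \<nu>) \<le> r0 powr (1 + \<nu>) * (1 / real k) powr ((1 + \<nu>) / 2)" .
  have "max_fun m f (x (Suc i))
      \<le> linearization m f f' (x i) (x (Suc i)) + L / (1 + \<nu>) * n powr (1 + \<nu>)"
    unfolding n_def by (intro max_fun_le_linearization assms xQ)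
  then have "composite m f \<psi> (x (Suc i)) \<le> Fstar + L / (1 + \<nu>) * n powr (1 + \<nu>)"
    using model_le[of i] by (simp add: composite_def h_def)
  also have "\<dots> \<le> Fstar + L / (1 + \<nu>) * (r0 powr (1 + \<nu>) * (1 / real k) powr ((1 + \<nu>) / 2))"
    using n assms(8,10) by (intro add_left_mono mult_left_mono) auto
  finally have "composite m f \<psi> (x (Suc i))
      \<le> Fstar + L * r0 powr (1 + \<nu>) / (1 + \<nu>) * (1 / real k) powr ((1 + \<nu>) / 2)"
    by simp
  \<comment> \<open>The good iterate is the endpoint of the short step; \<open>i < k\<close> keeps
    \<open>Suc i\<close> within \<open>{0..k}\<close>.\<close>
  moreover have "(MIN i\<in>{0..k}. composite m f \<psi> (x i)) \<le> composite m f \<psi> (x (Suc i))"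
    using i by (intro Min_le) auto
  ultimately show "(MIN i\<in>{0..k}. composite m f \<psi> (x i))
      \<le> Fstar + L * r0 powr (1 + \<nu>) / (1 + \<nu>) * (1 / real k) powr ((1 + \<nu>) / 2)"
    by linarith
qed

end
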